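(* Let $T$ be a complete branching tree for the problem $\min\{f(x) \mid x\in F,\ x\in D\}$ (with a relaxation function as described in the context). Then $\theta(T)$ equals the optimal value of this problem (where the optimal value is $\infty$ if the problem is infeasible).
   Context: Consider the problem $\min\{f(x)\mid x\in F,\ x\in D\}$, where $x=(x_1,\ldots,x_n)$, $F$ is a set (the feasible set), $D=D_{x_1}\times\cdots\times D_{x_n}$, and each $D_{x_j}$ is a finite domain of variable $x_j$; its optimal value is $\infty$ if $F\cap D=\emptyset$. Branching tree: a rooted tree $T$; for a node $u$, $P[u]$ is the path from the root to $u$; $u$ is on level $j$ if $P[u]$ has $j-1$ arcs; a terminal node is a node on level $n+1$. $T$ is a branching tree if (a) every nonterminal node $u$ is labeled with a variable $x_{j(u)}$, and the nodes on $P[u]$ have distinct labels; (b) the arcs from any nonleaf node $u$ to its children are associated with distinct values in $D_{x_{j(u)}}$, each such value viewed as an assignment to $x_{j(u)}$. The arcs of $P[u]$ define a partial assignment $x[u]$ (a complete assignment if $u$ is terminal). Relaxation values: each node $u$ has a value $c_u=c(x[u])\in\mathbb{R}\cup\{\infty\}$ given by a function $c$ of the partial assignment alone, such that: $c_u\le f(x)$ for every $x\in F\cap D$ consistent with $x[u]$; $c_t\le c_u$ whenever $t$ is the parent of $u$; and for a terminal node $u$, $c_u$ is exactly the value of the assignment $x[u]$, i.e. $c_u=f(x[u])$ if $x[u]\in F$ and $c_u=\infty$ otherwise. A node $u$ is infeasible if $c_u=\infty$ and feasible otherwise. An open node is a nonterminal node $u$ with fewer than $|D_{x_{j(u)}}|$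 children; a node that is not open is closed. The bound established by $T$ is $\theta(T)=\min\{c_u: u \text{ a terminal or open node of } T\}$ (the minimum over the empty set being $\infty$). $T$ is complete if every node of $T$ is closed or infeasible. *)

theory Defs
  imports "HOL-Library.Extended_Real" "Graph_Theory.Arc_Walk"
begin

(* The index set of the variables is {1..n}. A partial assignment is a map; the complete
   assignments in D_1 x ... x D_n are the maps in \<open>domain_product\<close>. The type 'a only contains
   all the domains, which may differ from variable to variable. *)

locale optimization_problem =
  fixes n :: nat
    and Dom :: "nat \<Rightarrow> 'a set"
    and F :: "(nat \<rightharpoonup> 'a) set"
    and f :: "(nat \<rightharpoonup> 'a) \<Rightarrow> real"
  assumes finite_Dom: "j \<in> {1..n} \<Longrightarrow> finite (Dom j)"

definition domain_product :: "nat \<Rightarrow> (nat \<Rightarrow> 'a set) \<Rightarrow> (nat \<rightharpoonup> 'a) set" where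
  "domain_product n Dom = {x. dom x = {1..n} \<and> (\<forall>j\<in>{1..n}. the (x j) \<in> Dom j)}"

(* For use on finite sets only: Min is unspecified on infinite ones. *)
definition min_or_infinity :: "ereal set \<Rightarrow> ereal" where
  "min_or_infinity S = (if S = {} then \<infinity> else Min S)"

definition optimal_value ::
    "nat \<Rightarrow> (nat \<Rightarrow> 'a set) \<Rightarrow> (nat \<rightharpoonup> 'a) set \<Rightarrow> ((nat \<rightharpoonup> 'a) \<Rightarrow> real) \<Rightarrow> ereal" where
  "optimal_value n Dom F f = min_or_infinity {ereal (f x) | x. x \<in> F \<inter> domain_product n Dom}"

locale rooted_tree = wf_digraph T for T :: "('v, 'e) pre_digraph" +
  fixes root :: 'v
  assumes root_in_T: "root \<in> verts T"
    and unique_awalk: "v \<in> verts T \<Longrightarrow> \<exists>!p. awalk root p v"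
begin

definition root_path :: "'v \<Rightarrow> 'e list" where
  "root_path u = (THE p. awalk root p u)"

definition level :: "'v \<Rightarrow> nat" where
  "level u = length (root_path u) + 1"

definition children :: "'v \<Rightarrow> 'v set" where
  "children u = {v. u \<rightarrow>\<^bsub>T\<^esub> v}"

end

(* \<open>var u\<close> is meaningful only for nonterminal u; terminal nodes carry no label. *)

locale branching_tree = optimization_problem n Dom F f + rooted_tree T root
  for n :: nat
    and Dom :: "nat \<Rightarrow> 'a set"
    and F :: "(nat \<rightharpoonup> 'a) set"
    and f :: "(nat \<rightharpoonup> 'a) \<Rightarrow> real"
    and T :: "('v, 'e) pre_digraph"
    and root :: 'v +
  fixes var :: "'v \<Rightarrow> nat"
    and val :: "'e \<Rightarrow> 'a"
  assumes var_in_range: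
      "\<lbrakk>u \<in> verts T; level u \<noteq> n + 1\<rbrakk> \<Longrightarrow> var u \<in> {1..n}"
    and distinct_vars:
      "\<lbrakk>u \<in> verts T; level u \<noteq> n + 1\<rbrakk> \<Longrightarrow> distinct (map var (awalk_verts root (root_path u)))"
    and val_in_Dom: "\<lbrakk>u \<in> verts T; e \<in> out_arcs T u\<rbrakk> \<Longrightarrow> val e \<in> Dom (var u)"
    and distinct_vals: "u \<in> verts T \<Longrightarrow> inj_on val (out_arcs T u)"
begin

definition terminal :: "'v \<Rightarrow> bool" where
  "terminal u \<longleftrightarrow> u \<in> verts T \<and> level u = n + 1"

(* x[u]; the order in which \<open>map_of\<close> reads the arcs is irrelevant, since the labels along a
   root path are distinct. *)
definition assignment :: "'v \<Rightarrow> (nat \<rightharpoonup> 'a)" where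
  "assignment u = map_of (map (\<lambda>e. (var (tail T e), val e)) (root_path u))"

definition open_node :: "'v \<Rightarrow> bool" where
  "open_node u \<longleftrightarrow>
     u \<in> verts T \<and> \<not> terminal u \<and> card (children u) < card (Dom (var u))"

definition closed_node :: "'v \<Rightarrow> bool" where
  "closed_node u \<longleftrightarrow> u \<in> verts T \<and> \<not> open_node u"

end

locale relaxed_branching_tree = branching_tree n Dom F f T root var val
  for n :: nat
    and Dom :: "nat \<Rightarrow> 'a set"
    and F :: "(nat \<rightharpoonup> 'a) set"
    and f :: "(nat \<rightharpoonup> 'a) \<Rightarrow> real"
    and T :: "('v, 'e) pre_digraph"
    and root :: 'v
    and var :: "'v \<Rightarrow> nat"
    and val :: "'e \<Rightarrow> 'a" +
  fixes c :: "(nat \<rightharpoonup> 'a) \<Rightarrow> ereal"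
  assumes c_not_minus_infinity: "u \<in> verts T \<Longrightarrow> c (assignment u) \<noteq> -\<infinity>"
    and c_lower_bound:
      "\<lbrakk>u \<in> verts T; x \<in> F \<inter> domain_product n Dom; assignment u \<subseteq>\<^sub>m x\<rbrakk>
        \<Longrightarrow> c (assignment u) \<le> ereal (f x)"
    and c_parent_le:
      "\<lbrakk>t \<in> verts T; u \<in> children t\<rbrakk> \<Longrightarrow> c (assignment t) \<le> c (assignment u)"
    and c_terminal:
      "terminal u \<Longrightarrow>
        c (assignment u) = (if assignment u \<in> F then ereal (f (assignment u)) else \<infinity>)"
begin

definition infeasible :: "'v \<Rightarrow> bool" where
  "infeasible u \<longleftrightarrow> u \<in> verts T \<and> c (assignment u) = \<infinity>"

definition complete :: bool where
  "complete \<longleftrightarrow> (\<forall>u\<in>verts T. closed_node u \<or> infeasible u)"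

definition bound :: ereal where
  "bound = min_or_infinity {c (assignment u) | u. terminal u \<or> open_node u}"

end

end

theory Submission
  imports Defs
begin

text \<open>
  In a complete tree every open node is infeasible, so only terminal nodes contribute finite values
  to the bound, and the finite ones among these are objective values of feasible points.
  Conversely, a feasible \<open>x\<close> can be followed down the tree: a node consistent with \<open>x\<close> has a
  relaxation value at most \<open>f x\<close>, so it is feasible and hence closed, and if it is nonterminal
  then some child agrees with \<open>x\<close>.  Thus the bound and the optimal value are minima of sets that
  differ at most by the element \<open>\<infinity>\<close>.
\<close>

section \<open>Minima with default \<open>\<infinity>\<close>, and finiteness of sets of partial
  maps\<close>

text \<open>\<open>\<infinity>\<close> is neutral for the minimum of a nonempty finite set and is
  also the default at the empty set.\<close>

lemma min_or_infinity_eqI: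
  assumes "finite S" "A \<subseteq> S" "S \<subseteq> insert \<infinity> A"
  shows "min_or_infinity S = min_or_infinity A"
proof (cases "A = {}")
  case True
  with assms(3) have "S = {} \<or> S = {\<infinity>}" by blast
  with True show ?thesis by (auto simp: min_or_infinity_def)
next
  case False
  have fin: "finite A" using assms(1,2) finite_subset by blast
  have "S = A \<or> S = insert \<infinity> A" using assms(2,3) by blast
  moreover have "Min (insert \<infinity> A) = Min A" using False fin by simp
  ultimately show ?thesis using False by (auto simp: min_or_infinity_def)
qed

lemma finite_partial_assignments:
  assumes "finite I" "\<And>j. j \<in> I \<Longrightarrow> finite (D j)"
  shows "finite {m. dom m \<subseteq> I \<and> (\<forall>j\<in>dom m. the (m j) \<in> D j)}" (is "finite ?M")
proof (rule finite_subset)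
  \<comment> \<open>Fixing the domain \<open>J\<close> and enlarging every \<open>D j\<close> to one
    common codomain gives the form that \<open>finite_set_of_finite_maps\<close> handles.\<close>
  show "?M \<subseteq> (\<Union>J\<in>Pow I. {m. dom m = J \<and> ran m \<subseteq> (\<Union>j\<in>I. D j)})"
    by (fastforce simp: ran_def dom_def)
  have "finite {m. dom m = J \<and> ran m \<subseteq> (\<Union>j\<in>I. D j)}" if "J \<in> Pow I" for J
    using that assms by (intro finite_set_of_finite_maps) (auto intro: finite_subset)
  then show "finite (\<Union>J\<in>Pow I. {m. dom m = J \<and> ran m \<subseteq> (\<Union>j\<in>I. D j)})"
    using assms(1) by blast
qed

section \<open>Root paths in a rooted tree\<close>

context rooted_tree
begin

lemma awalk_root_path: "u \<in> verts T \<Longrightarrow> awalk root (root_path u) u"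
  unfolding root_path_def using unique_awalk by (rule theI')

lemma root_path_eqI:
  assumes "awalk root p u"
  shows "root_path u = p"
  using assms awalk_root_path unique_awalk by (metis awalkE' awalk_last_in_verts)

lemma root_path_root: "root_path root = []"
  using root_in_T by (intro root_path_eqI) (simp add: awalk_Nil_iff)

lemma root_path_head:
  assumes "e \<in> out_arcs T u"
  shows "root_path (head T e) = root_path u @ [e]"
proof (rule root_path_eqI)
  have "u \<in> verts T" using assms by auto
  then have "awalk root (root_path u) u" by (rule awalk_root_path)
  moreover have "awalk u [e] (head T e)" using assms arc_implies_awalk by force
  ultimately show "awalk root (root_path u @ [e]) (head T e)" by (rule awalk_appendI)
qed

text \<open>Separates the nodes whose labels \<open>assignment u\<close> binds from \<open>u\<close>
  itself, whose label is still unassigned.\<close>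

lemma awalk_verts_root_path:
  assumes "u \<in> verts T"
  shows "awalk_verts root (root_path u) = map (tail T) (root_path u) @ [u]"
  using awalk_root_path[OF assms] by (auto simp: awalk_verts_conv awalk_conv)

lemma children_eq_head_image: "children u = head T ` out_arcs T u"
  by (auto simp: children_def arcs_ends_def arc_to_ends_def)

text \<open>Removing the last arc of the root path leads to the parent, so induction on that path
  from its end suffices.\<close>

lemma tree_induct [consumes 1, case_names root arc]:
  assumes "u \<in> verts T"
    and "P root"
    and "\<And>u e. \<lbrakk>e \<in> out_arcs T u; u \<in> verts T; P u\<rbrakk> \<Longrightarrow> P (head T e)"
  shows "P u"
proof -
  have "awalk root p u \<Longrightarrow> P u" for p
  proof (induction p arbitrary: u rule: rev_induct)
    case Nil
    then show ?case using assms(2) by (simp add: awalk_Nil_iff)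
  next
    case (snoc e p)
    then have "awalk root p (tail T e)" "e \<in> out_arcs T (tail T e)" "u = head T e"
      by (auto simp: awalk_append_iff awalk_simps)
    with snoc.IH assms(3) show ?case by (metis awalk_last_in_verts)
  qed
  then show ?thesis using awalk_root_path[OF assms(1)] by blast
qed

end

section \<open>Labels and partial assignments along root paths\<close>

context branching_tree
begin

lemma level_head: "e \<in> out_arcs T u \<Longrightarrow> level (head T e) = level u + 1"
  by (simp add: level_def root_path_head)

lemma distinct_path_vars:
  assumes "u \<in> verts T" "level u \<noteq> n + 1"
  shows "distinct (map (var \<circ> tail T) (root_path u) @ [var u])"
  using distinct_vars[OF assms] by (simp add: awalk_verts_root_path assms(1))

text \<open>Proved jointly because the bound on the level comes from counting distinct labels in
  \<open>{1..n}\<close>. Distinctness at a terminal node is inherited from its parent, whose own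
  label ends the list.\<close>

lemma level_le_and_path_labels:
  assumes "u \<in> verts T"
  shows "level u \<le> n + 1 \<and> distinct (map (var \<circ> tail T) (root_path u)) \<and>
    (\<forall>e\<in>set (root_path u). var (tail T e) \<in> {1..n} \<and> val e \<in> Dom (var (tail T e)))"
  using assms
proof (induction rule: tree_induct)
  case root
  then show ?case by (simp add: level_def root_path_root)
next
  case (arc u e)
  let ?v = "head T e"
  have v: "?v \<in> verts T" using arc by auto
  have tail: "tail T e = u" using arc by simp
  \<comment> \<open>The arcs above a node on level \<open>n + 1\<close> use up all labels, so it cannot have a child.\<close>
  have nonterm: "level u \<noteq> n + 1"
  proof
    assume lev: "level u = n + 1"
    let ?L = "map (var \<circ> tail T) (root_path u)"
    have "card (set ?L) = n"
      using arc lev distinct_card[of ?L] by (simp add: level_def comp_def)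
    moreover have "set ?L \<subseteq> {1..n}" using arc by auto
    ultimately have "set ?L = {1..n}" by (intro card_subset_eq) auto
    \<comment> \<open>The child would be on level \<open>n + 2\<close>, where the label assumptions
      apply again: its own label must be new and in \<open>{1..n}\<close>.\<close>
    moreover have lv: "level ?v \<noteq> n + 1" using level_head[OF arc(1)] lev by simp
    then have "var ?v \<in> {1..n}" by (rule var_in_range[OF v])
    ultimately show False
      using distinct_path_vars[OF v lv] by (auto simp: root_path_head[OF arc(1)])
  qed
  then have "var u \<in> {1..n}" "val e \<in> Dom (var u)"
    using arc var_in_range val_in_Dom by blast+
  then show ?case
    using arc nonterm tail distinct_path_vars[of u]
    by (auto simp: root_path_head[OF arc(1)] level_head[OF arc(1)])
qed

lemma dom_assignment: "dom (assignment u) = (var \<circ> tail T) ` set (root_path u)"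
  by (simp add: assignment_def dom_map_of_conv_image_fst image_image)

lemma assignment_in_Dom:
  assumes "u \<in> verts T" "j \<in> dom (assignment u)"
  shows "the (assignment u j) \<in> Dom j"
proof -
  obtain a where a: "assignment u j = Some a" using assms(2) by blast
  then have "(j, a) \<in> set (map (\<lambda>e. (var (tail T e), val e)) (root_path u))"
    unfolding assignment_def by (rule map_of_SomeD)
  with level_le_and_path_labels[OF assms(1)] a show ?thesis by auto
qed

lemma dom_assignment_subset: "u \<in> verts T \<Longrightarrow> dom (assignment u) \<subseteq> {1..n}"
  using level_le_and_path_labels[of u] by (auto simp: dom_assignment)

text \<open>Makes the set of relaxation values finite, as \<open>Min\<close> requires, without
  counting the nodes.\<close>

lemma finite_assignments: "finite (assignment ` verts T)"
proof (rule finite_subset)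
  show "assignment ` verts T
      \<subseteq> {m. dom m \<subseteq> {1..n} \<and> (\<forall>j\<in>dom m. the (m j) \<in> Dom j)}"
    using dom_assignment_subset assignment_in_Dom by blast
qed (intro finite_partial_assignments finite_Dom finite_atLeastAtMost)

text \<open>The \<open>n\<close> arcs of the root path carry distinct labels in
  \<open>{1..n}\<close>, so every variable is assigned.\<close>

lemma terminal_assignment:
  assumes "terminal u"
  shows "assignment u \<in> domain_product n Dom"
proof -
  have u: "u \<in> verts T" and lev: "level u = n + 1"
    using assms by (auto simp: terminal_def)
  have "card (set (map (var \<circ> tail T) (root_path u))) = n"
    using level_le_and_path_labels[OF u] lev
      distinct_card[of "map (var \<circ> tail T) (root_path u)"] by (simp add: level_def)
  then have "dom (assignment u) = {1..n}"
    using dom_assignment_subset[OF u] by (intro card_subset_eq) (auto simp: dom_assignment)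
  then show ?thesis
    using assignment_in_Dom[OF u] by (auto simp: domain_product_def)
qed

text \<open>In \<open>map_of\<close> the earlier arcs take precedence over the appended one, but
  \<open>var u\<close> is fresh, so no binding is shadowed.\<close>

lemma assignment_head:
  assumes "e \<in> out_arcs T u" "level u \<noteq> n + 1"
  shows "assignment (head T e) = (assignment u)(var u \<mapsto> val e)"
proof -
  have "u \<in> verts T" using assms by auto
  then have "var u \<notin> dom (assignment u)"
    using distinct_path_vars assms(2) by (simp add: dom_assignment)
  then show ?thesis
    using assms(1) by (auto simp: assignment_def root_path_head map_of_append map_add_def fun_eq_iff
        split: option.splits)
qed

text \<open>Children number at least \<open>card (Dom (var u))\<close> and at most as many as the
  arcs, whose values are distinct elements of that finite domain.\<close>

lemma closed_node_vals:
  assumes "closed_node u" "\<not> terminal u"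
  shows "val ` out_arcs T u = Dom (var u)"
proof -
  have u: "u \<in> verts T" and card: "card (Dom (var u)) \<le> card (children u)"
    using assms by (auto simp: closed_node_def open_node_def)
  have fin: "finite (Dom (var u))"
    using assms(2) u var_in_range finite_Dom by (auto simp: terminal_def)
  have sub: "val ` out_arcs T u \<subseteq> Dom (var u)" using val_in_Dom u by blast
  have inj: "inj_on val (out_arcs T u)" using distinct_vals u by blast
  \<comment> \<open>Needed because \<open>card\<close> is 0 on infinite sets; \<open>val\<close>
    embeds the arcs into the finite domain.\<close>
  have "finite (out_arcs T u)" using finite_imageD[OF finite_subset[OF sub fin] inj] .
  then have "card (children u) \<le> card (out_arcs T u)"
    unfolding children_eq_head_image by (rule card_image_le)
  also have "\<dots> = card (val ` out_arcs T u)" using inj by (simp add: card_image)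
  finally show ?thesis using card card_seteq[OF fin sub] by simp
qed

end

section \<open>Following a feasible point down a complete tree\<close>

context relaxed_branching_tree
begin

text \<open>Here \<open>k\<close> counts the arcs above the node: \<open>k = 0\<close> is the root
  with the empty assignment, and \<open>k = n\<close> gives a terminal node.\<close>

lemma ex_consistent_node:
  assumes complete and x: "x \<in> F \<inter> domain_product n Dom" and "k \<le> n"
  shows "\<exists>u\<in>verts T. level u = k + 1 \<and> assignment u \<subseteq>\<^sub>m x"
  using \<open>k \<le> n\<close>
proof (induction k)
  case 0
  then show ?case
    using root_in_T by (intro bexI[of _ root]) (auto simp: level_def assignment_def root_path_root)
next
  case (Suc k)
  then obtain u where u: "u \<in> verts T" "level u = k + 1" "assignment u \<subseteq>\<^sub>m x" by auto
  have lev: "level u \<noteq> n + 1" using u(2) Suc.prems by simp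
  have "c (assignment u) \<le> ereal (f x)" using c_lower_bound u x by blast
  then have "closed_node u"
    using assms(1) u(1) by (auto simp: complete_def infeasible_def)
  then have "val ` out_arcs T u = Dom (var u)"
    using closed_node_vals lev by (simp add: terminal_def)
  moreover have j: "var u \<in> {1..n}" using var_in_range u(1) lev .
  then have "the (x (var u)) \<in> Dom (var u)" "var u \<in> dom x"
    using x by (auto simp: domain_product_def)
  ultimately obtain e where e: "e \<in> out_arcs T u" "x (var u) = Some (val e)" by force
  then have "assignment (head T e) \<subseteq>\<^sub>m x"
    using u(3) lev by (auto simp: assignment_head map_le_def)
  then show ?case using e(1) u(2) level_head[OF e(1)] by (intro bexI[of _ "head T e"]) auto
qed

text \<open>At a terminal node both maps have domain \<open>{1..n}\<close>, so consistency becomes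
  equality.\<close>

lemma ex_terminal_node:
  assumes complete and x: "x \<in> F \<inter> domain_product n Dom"
  obtains u where "terminal u" "assignment u = x"
proof -
  obtain u where u: "u \<in> verts T" "level u = n + 1" "assignment u \<subseteq>\<^sub>m x"
    using ex_consistent_node[OF assms order_refl] by blast
  then have t: "terminal u" by (simp add: terminal_def)
  then have "dom (assignment u) = dom x"
    using terminal_assignment x by (auto simp: domain_product_def)
  then have "assignment u = x"
    using u(3) by (auto simp: map_le_def intro: map_le_antisym)
  with t that show thesis by blast
qed

lemma bound_eq_optimal_value:
  assumes complete
  shows "bound = optimal_value n Dom F f"
  unfolding bound_def optimal_value_def
proof (rule min_or_infinity_eqI)
  have "{c (assignment u) | u. terminal u \<or> open_node u} \<subseteq> c ` assignment ` verts T"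
    by (auto simp: terminal_def open_node_def)
  then show "finite {c (assignment u) | u. terminal u \<or> open_node u}"
    by (rule finite_subset) (simp add: finite_assignments)
  \<comment> \<open>This inclusion rests on \<open>c\<close> being exact, not merely a lower bound,
    at terminal nodes.\<close>
  show "{ereal (f x) | x. x \<in> F \<inter> domain_product n Dom}
      \<subseteq> {c (assignment u) | u. terminal u \<or> open_node u}"
  proof clarify
    fix x assume x: "x \<in> F" "x \<in> domain_product n Dom"
    then obtain u where "terminal u" "assignment u = x"
      using ex_terminal_node[OF assms] by blast
    with x(1) show "\<exists>u. ereal (f x) = c (assignment u) \<and> (terminal u \<or> open_node u)"
      using c_terminal by (metis (full_types))
  qed
  have "c (assignment u) \<in> insert \<infinity> {ereal (f x) | x. x \<in> F \<inter> domain_product n Dom}"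
    if "terminal u \<or> open_node u" for u
    using that
  proof
    assume "terminal u"
    then show ?thesis using c_terminal[of u] terminal_assignment[of u] by auto
  next
    assume "open_node u"
    then show ?thesis
      using assms by (auto simp: complete_def closed_node_def infeasible_def open_node_def)
  qed
  then show "{c (assignment u) | u. terminal u \<or> open_node u}
      \<subseteq> insert \<infinity> {ereal (f x) | x. x \<in> F \<inter> domain_product n Dom}"
    by blast
qed

end

theorem theorem1:
  fixes n :: nat
    and Dom :: "nat \<Rightarrow> 'a set"
    and F :: "(nat \<rightharpoonup> 'a) set"
    and f :: "(nat \<rightharpoonup> 'a) \<Rightarrow> real"
    and T :: "('v, 'e) pre_digraph"
    and root :: 'v
    and var :: "'v \<Rightarrow> nat"
    and val :: "'e \<Rightarrow> 'a"
    and c :: "(nat \<rightharpoonup> 'a) \<Rightarrow> ereal"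
  assumes "relaxed_branching_tree n Dom F f T root var val c"
    and "relaxed_branching_tree.complete n Dom T root var val c"
  shows "relaxed_branching_tree.bound n Dom T root var val c = optimal_value n Dom F f"
  using assms by (rule relaxed_branching_tree.bound_eq_optimal_value)

end
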